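(* Let $G\subset U(M)$ be freely generated with generators $g_1,\dots,g_n$. Let $\mathcal{V}\subset G$ be a finite positive normal constellation which contains the identity element $I$ and has $L\ge 3$ elements. If $\mathcal{V}$ has a weak group structure, then $\mathcal{V}$ takes one of the following forms: - $\mathcal{V}=\{I,A,A^2,\dots,A^{L-1}\}$, - $\mathcal{V}=\{I,AB,A^2B^2,\dots,A^{L-1}B^{L-1}\}$, where $A=g_i^{p_i}$ and $B=g_j^{p_j}$ for some $i\ne j$ and some integers $p_i,p_j$ (only $A$ being relevant in the first form).
   Context: $U(M)$ is the group of $M\times M$ complex unitary matrices. Freely generated: let $F$ be the free group on a set $\{x_1,\dots,x_n\}$. $G\subset U(M)$ is freely generated, with generators $g_1,\dots,g_n\in G$, if the homomorphism $\phi:F\to G$ with $\phi(x_i)=g_i$ is an isomorphism (so $G$ is a free subgroup of $U(M)$ with free basis $g_1,\dots,g_n$). Reduced form: every $g\in G$ can be written $g=\prod_{i=1}^k a_i^{p_i}=a_1^{p_1}a_2^{p_2}\cdots a_k^{p_k}$ with each $a_i\in\{g_1,\dots,g_n\}$ and each $p_i$ a nonzero integer; the expression is reduced if $a_i\ne a_{i+1}$ for all consecutive indices (the reduced form is unique). Normal: an element with reduced form $\prod_{i=1}^k a_i^{p_i}$ is normal if $a_i\ne a_j$ for all $i\ne j$. A subset of $G$ is a normal constellation if each of its non-identity elements is normal. Positive: an element with reduced form $\prod_{i=1}^k a_i^{p_i}$ is positive if $p_i>0$ for all $i$. A subset of $G$ is a positive constellation if each of its non-identity elements is positive. A positive normal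 constellation is a subset of $G$ which is both a positive constellation and a normal constellation. Equivalence: $A,B\in G$ are equivalent, $A\sim B$, if there is $U\in G$ such that $A=UBU^{-1}$ or $A=UB^{-1}U^{-1}$. Weak group structure: $\mathcal{V}\subset G$ has a weak group structure if for any two distinct elements $\Psi,\Psi'\in\mathcal{V}$, the product $\Psi^{-1}\Psi'$ is equivalent to some element of $\mathcal{V}$. *)

theory Defs
  imports "HOL-Analysis.Analysis" "HOL-Algebra.Group"
begin

section \<open>The unitary group\<close>

definition conjugate_transpose :: "complex^'m^'m \<Rightarrow> complex^'m^'m" where
  "conjugate_transpose A = (\<chi> i j. cnj (A $ j $ i))"

definition unitary_matrix :: "complex^'m^'m \<Rightarrow> bool" where
  "unitary_matrix A \<longleftrightarrow>
     conjugate_transpose A ** A = mat 1 \<and> A ** conjugate_transpose A = mat 1"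

definition unitary_group :: "(complex^'m^'m) monoid" where
  "unitary_group = \<lparr>carrier = {A. unitary_matrix A}, mult = (**), one = mat 1\<rparr>"

text \<open>The group structure on a subgroup of the unitary group given by its underlying set.\<close>

abbreviation unitary_subgroup :: "(complex^'m^'m) set \<Rightarrow> (complex^'m^'m) monoid" where
  "unitary_subgroup G \<equiv> unitary_group\<lparr>carrier := G\<rparr>"

lemma conjugate_transpose_mult:
  "conjugate_transpose (A ** B) = conjugate_transpose B ** conjugate_transpose A"
  by (simp add: conjugate_transpose_def matrix_matrix_mult_def vec_eq_iff mult.commute)

lemma conjugate_transpose_invol [simp]:
  "conjugate_transpose (conjugate_transpose A) = A"
  by (simp add: conjugate_transpose_def vec_eq_iff)

lemma conjugate_transpose_one [simp]: "conjugate_transpose (mat 1) = mat 1"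
  by (auto simp: conjugate_transpose_def mat_def vec_eq_iff)

lemma group_unitary_group: "group (unitary_group :: (complex^'m^'m) monoid)"
proof (rule groupI)
  fix A B :: "complex^'m^'m"
  assume "A \<in> carrier unitary_group" and "B \<in> carrier unitary_group"
  then have A: "conjugate_transpose A ** A = mat 1" "A ** conjugate_transpose A = mat 1"
    and B: "conjugate_transpose B ** B = mat 1" "B ** conjugate_transpose B = mat 1"
    by (auto simp: unitary_group_def unitary_matrix_def)
  have "conjugate_transpose B ** conjugate_transpose A ** (A ** B)
      = conjugate_transpose B ** (conjugate_transpose A ** A) ** B"
    by (simp add: matrix_mul_assoc)
  moreover have "A ** B ** (conjugate_transpose B ** conjugate_transpose A)
      = A ** (B ** conjugate_transpose B) ** conjugate_transpose A"
    by (simp add: matrix_mul_assoc)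
  ultimately show "A \<otimes>\<^bsub>unitary_group\<^esub> B \<in> carrier unitary_group"
    using A B by (simp add: unitary_group_def unitary_matrix_def conjugate_transpose_mult)
next
  fix A :: "complex^'m^'m"
  assume "A \<in> carrier unitary_group"
  then show "\<exists>B\<in>carrier unitary_group. B \<otimes>\<^bsub>unitary_group\<^esub> A = \<one>\<^bsub>unitary_group\<^esub>"
    by (auto simp: unitary_group_def unitary_matrix_def intro!: exI[of _ "conjugate_transpose A"])
qed (auto simp: unitary_group_def unitary_matrix_def matrix_mul_assoc)


section \<open>Free groups\<close>

text \<open>
  The free group on a set \<open>X\<close>, realised by freely reduced words: the letter \<open>(x, True)\<close> stands
  for \<open>x\<close> and \<open>(x, False)\<close> for its inverse. Two words are multiplied by concatenation followed by
  free reduction; as the right factor is already reduced, it suffices to put the letters of the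
  left factor in front of it one by one, cancelling whenever possible.
\<close>

type_synonym 'x letter = "'x \<times> bool"

definition inverse_letter :: "'x letter \<Rightarrow> 'x letter" where
  "inverse_letter a = (fst a, \<not> snd a)"

definition reduced_word :: "'x letter list \<Rightarrow> bool" where
  "reduced_word w \<longleftrightarrow> successively (\<lambda>a b. b \<noteq> inverse_letter a) w"

fun cons_letter :: "'x letter \<Rightarrow> 'x letter list \<Rightarrow> 'x letter list" where
  "cons_letter a [] = [a]"
| "cons_letter a (b # w) = (if b = inverse_letter a then w else a # b # w)"

definition free_group :: "'x set \<Rightarrow> 'x letter list monoid" where
  "free_group X = \<lparr>carrier = {w. reduced_word w \<and> fst ` set w \<subseteq> X},
     mult = foldr cons_letter, one = []\<rparr>"

lemma inverse_letter_invol [simp]: "inverse_letter (inverse_letter a) = a"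
  by (simp add: inverse_letter_def)

lemma fst_inverse_letter [simp]: "fst (inverse_letter a) = fst a"
  by (simp add: inverse_letter_def)

lemma reduced_word_simps [simp]:
  "reduced_word []" "reduced_word [a]"
  "reduced_word (a # b # w) \<longleftrightarrow> b \<noteq> inverse_letter a \<and> reduced_word (b # w)"
  by (simp_all add: reduced_word_def)

lemma reduced_word_ConsD: "reduced_word (a # w) \<Longrightarrow> reduced_word w"
  by (cases w) auto

lemma reduced_cons_letter: "reduced_word w \<Longrightarrow> reduced_word (cons_letter a w)"
  by (cases w) (auto dest: reduced_word_ConsD)

lemma reduced_foldr_cons_letter:
  "reduced_word w \<Longrightarrow> reduced_word (foldr cons_letter u w)"
  by (induction u) (auto intro: reduced_cons_letter)

lemma letters_cons_letter: "set (cons_letter a w) \<subseteq> insert a (set w)"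
  by (cases w) auto

lemma letters_foldr_cons_letter: "set (foldr cons_letter u w) \<subseteq> set u \<union> set w"
proof (induction u)
  case (Cons a u)
  then show ?case
    using letters_cons_letter[of a "foldr cons_letter u w"] by auto
qed simp

lemma cons_letter_cancel:
  "reduced_word w \<Longrightarrow> cons_letter a (cons_letter (inverse_letter a) w) = w"
proof (cases w)
  case (Cons b v)
  assume "reduced_word w"
  with Cons show ?thesis
    by (cases v) auto
qed simp

lemma foldr_cons_letter_cons_letter:
  assumes "reduced_word w"
  shows "foldr cons_letter (cons_letter a v) w = cons_letter a (foldr cons_letter v w)"
proof (cases v)
  case (Cons b v')
  then show ?thesis
    using cons_letter_cancel[OF reduced_foldr_cons_letter[OF assms, of v'], of a] by auto
qed simp

lemma foldr_cons_letter_assoc: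
  assumes "reduced_word w"
  shows "foldr cons_letter (foldr cons_letter u v) w
    = foldr cons_letter u (foldr cons_letter v w)"
  by (induction u) (simp_all add: foldr_cons_letter_cons_letter[OF assms])

lemma foldr_cons_letter_Nil: "reduced_word w \<Longrightarrow> foldr cons_letter w [] = w"
proof (induction w)
  case (Cons a w)
  then show ?case
    by (cases w) (auto dest: reduced_word_ConsD)
qed simp

lemma foldr_cons_letter_inverse:
  assumes "reduced_word v"
  shows "foldr cons_letter (rev (map inverse_letter w)) (foldr cons_letter w v) = v"
proof (induction w)
  case (Cons a w)
  then show ?case
    using cons_letter_cancel[OF reduced_foldr_cons_letter[OF assms, of w], of "inverse_letter a"]
    by simp
qed (simp add: assms)

lemma group_free_group: "group (free_group X)"
proof (rule groupI)
  fix u v assume "u \<in> carrier (free_group X)" "v \<in> carrier (free_group X)"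
  then show "u \<otimes>\<^bsub>free_group X\<^esub> v \<in> carrier (free_group X)"
    using letters_foldr_cons_letter[of u v]
    by (fastforce simp: free_group_def intro: reduced_foldr_cons_letter)
next
  fix w assume w: "w \<in> carrier (free_group X)"
  let ?v = "foldr cons_letter (rev (map inverse_letter w)) []"
  have red: "reduced_word w" and fw: "foldr cons_letter w [] = w"
    using w by (auto simp: free_group_def foldr_cons_letter_Nil)
  have "set ?v \<subseteq> set (map inverse_letter w)"
    using letters_foldr_cons_letter[of "rev (map inverse_letter w)" "[]"] by simp
  from image_mono[OF this, of fst] have "fst ` set ?v \<subseteq> fst ` set w"
    by (simp add: image_image)
  with w have "?v \<in> carrier (free_group X)"
    by (auto simp: free_group_def intro: reduced_foldr_cons_letter)
  moreover have "foldr cons_letter ?v w = []"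
    using foldr_cons_letter_assoc[OF red, of "rev (map inverse_letter w)" "[]"]
      foldr_cons_letter_inverse[of "[]" w] fw by simp
  ultimately show "\<exists>v\<in>carrier (free_group X). v \<otimes>\<^bsub>free_group X\<^esub> w = \<one>\<^bsub>free_group X\<^esub>"
    by (intro bexI[of _ ?v]) (auto simp: free_group_def)
qed (auto simp: free_group_def foldr_cons_letter_assoc)

text \<open>
  The generators \<open>g\<^sub>1, \<dots>, g\<^sub>n\<close> are given by a family indexed by \<open>{1..n}\<close>; a homomorphism from
  the free group on \<open>{1..n}\<close> is determined by its values on the one-letter words.
\<close>

definition freely_generated :: "('a, 'b) monoid_scheme \<Rightarrow> nat \<Rightarrow> (nat \<Rightarrow> 'a) \<Rightarrow> bool" where
  "freely_generated G n g \<longleftrightarrow> group G \<and> (\<forall>i\<in>{1..n}. g i \<in> carrier G) \<and>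
     (\<exists>\<phi>\<in>iso (free_group {1..n}) G. \<forall>i\<in>{1..n}. \<phi> [(i, True)] = g i)"


section \<open>Reduced forms and constellations\<close>

text \<open>
  The expression \<open>a\<^sub>1\<^bsup>p\<^sub>1\<^esup> \<cdots> a\<^sub>k\<^bsup>p\<^sub>k\<^esup>\<close> is encoded as the list \<open>[(a\<^sub>1, p\<^sub>1), \<dots>, (a\<^sub>k, p\<^sub>k)]\<close>. Below, \<open>S\<close>
  is the set of free generators of \<open>G\<close>; then every element has exactly one reduced form, so that
  the existential quantifiers in \<open>normal_element\<close> and \<open>positive_element\<close> refer to that form.
\<close>

definition reduced_form ::
    "('a, 'b) monoid_scheme \<Rightarrow> 'a set \<Rightarrow> ('a \<times> int) list \<Rightarrow> 'a \<Rightarrow> bool" where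
  "reduced_form G S aps x \<longleftrightarrow>
     x = foldr (\<otimes>\<^bsub>G\<^esub>) (map (\<lambda>(a, p). a [^]\<^bsub>G\<^esub> p) aps) \<one>\<^bsub>G\<^esub> \<and>
     (\<forall>(a, p)\<in>set aps. a \<in> S \<and> p \<noteq> 0) \<and>
     successively (\<noteq>) (map fst aps)"

definition normal_element :: "('a, 'b) monoid_scheme \<Rightarrow> 'a set \<Rightarrow> 'a \<Rightarrow> bool" where
  "normal_element G S x \<longleftrightarrow> (\<exists>aps. reduced_form G S aps x \<and> distinct (map fst aps))"

definition positive_element :: "('a, 'b) monoid_scheme \<Rightarrow> 'a set \<Rightarrow> 'a \<Rightarrow> bool" where
  "positive_element G S x \<longleftrightarrow> (\<exists>aps. reduced_form G S aps x \<and> (\<forall>(a, p)\<in>set aps. p > 0))"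

definition normal_constellation :: "('a, 'b) monoid_scheme \<Rightarrow> 'a set \<Rightarrow> 'a set \<Rightarrow> bool" where
  "normal_constellation G S V \<longleftrightarrow>
     V \<subseteq> carrier G \<and> (\<forall>x\<in>V. x \<noteq> \<one>\<^bsub>G\<^esub> \<longrightarrow> normal_element G S x)"

definition positive_constellation :: "('a, 'b) monoid_scheme \<Rightarrow> 'a set \<Rightarrow> 'a set \<Rightarrow> bool" where
  "positive_constellation G S V \<longleftrightarrow>
     V \<subseteq> carrier G \<and> (\<forall>x\<in>V. x \<noteq> \<one>\<^bsub>G\<^esub> \<longrightarrow> positive_element G S x)"

definition positive_normal_constellation ::
    "('a, 'b) monoid_scheme \<Rightarrow> 'a set \<Rightarrow> 'a set \<Rightarrow> bool" where
  "positive_normal_constellation G S V \<longleftrightarrow>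
     positive_constellation G S V \<and> normal_constellation G S V"

definition equivalent :: "('a, 'b) monoid_scheme \<Rightarrow> 'a \<Rightarrow> 'a \<Rightarrow> bool" where
  "equivalent G A B \<longleftrightarrow> A \<in> carrier G \<and> B \<in> carrier G \<and>
     (\<exists>U\<in>carrier G. A = U \<otimes>\<^bsub>G\<^esub> B \<otimes>\<^bsub>G\<^esub> inv\<^bsub>G\<^esub> U \<or>
                    A = U \<otimes>\<^bsub>G\<^esub> inv\<^bsub>G\<^esub> B \<otimes>\<^bsub>G\<^esub> inv\<^bsub>G\<^esub> U)"

definition weak_group_structure :: "('a, 'b) monoid_scheme \<Rightarrow> 'a set \<Rightarrow> bool" where
  "weak_group_structure G V \<longleftrightarrow> V \<subseteq> carrier G \<and>
     (\<forall>\<Psi>\<in>V. \<forall>\<Psi>'\<in>V. \<Psi> \<noteq> \<Psi>' \<longrightarrow> (\<exists>\<Phi>\<in>V. equivalent G (inv\<^bsub>G\<^esub> \<Psi> \<otimes>\<^bsub>G\<^esub> \<Psi>') \<Phi>))"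

end

theory Submission
  imports Defs "HOL-Algebra.Elementary_Groups"
begin

text \<open>
  Positivity and normality make an element of \<open>V\<close> a product of distinct generators with positive
  exponents, and the weak group structure passes to the exponent vectors: the difference of two of
  them is, up to sign, again one of them. Hence the total exponents are the multiples
  \<open>0, \<delta>, \<dots>, (L - 1) \<delta>\<close> of a number \<open>\<delta>\<close>, the element \<open>x\<^sub>k\<close> of total exponent \<open>k \<delta>\<close> has \<open>k\<close> times the
  exponents of \<open>x\<^sub>1\<close>, and \<open>x\<^sub>1\<^sup>-\<^sup>1 x\<^sub>k\<^sub>+\<^sub>1\<close> is conjugate to \<open>x\<^sub>k\<close>. Only the order of the generators in
  \<open>x\<^sub>k\<close> is left open. It is read off from traces under homomorphisms to \<open>SL\<^sub>2(\<int>)\<close> that send each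
  generator to \<open>1\<close> or to one of two opposite unipotent matrices: equality of the traces forces all
  \<open>x\<^sub>k\<close> to have the same order of generators, and at most two generators to occur.
\<close>

section \<open>Homomorphisms out of a free group\<close>

definition eval_word :: "('b, 'c) monoid_scheme \<Rightarrow> ('x \<Rightarrow> 'b) \<Rightarrow> 'x letter list \<Rightarrow> 'b" where
  "eval_word H h w =
     foldr (\<lambda>a z. (if snd a then h (fst a) else inv\<^bsub>H\<^esub> h (fst a)) \<otimes>\<^bsub>H\<^esub> z) w \<one>\<^bsub>H\<^esub>"

lemma eval_word_simps [simp]:
  "eval_word H h [] = \<one>\<^bsub>H\<^esub>"
  "eval_word H h (a # w) =
     (if snd a then h (fst a) else inv\<^bsub>H\<^esub> h (fst a)) \<otimes>\<^bsub>H\<^esub> eval_word H h w"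
  by (simp_all add: eval_word_def)

context group
begin

lemma eval_word_closed:
  assumes "fst ` set w \<subseteq> X" and "h \<in> X \<rightarrow> carrier G"
  shows "eval_word G h w \<in> carrier G"
  using assms by (induction w) auto

text \<open>When \<open>cons_letter\<close> cancels, the head of \<open>w\<close> evaluates to the
  inverse of the value of \<open>a\<close>, so the cancelled pair contributes nothing to the
  product.\<close>

lemma eval_word_cons_letter:
  assumes "fst a \<in> X" and "fst ` set w \<subseteq> X" and h: "h \<in> X \<rightarrow> carrier G"
  shows "eval_word G h (cons_letter a w) = eval_word G h [a] \<otimes> eval_word G h w"
proof (cases w)
  case (Cons b v)
  have "eval_word G h v \<in> carrier G" "h (fst a) \<in> carrier G"
    using assms Cons by (auto intro!: eval_word_closed[OF _ h])
  with Cons show ?thesis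
    by (auto simp: inverse_letter_def m_assoc[symmetric])
qed (use assms in \<open>auto simp: Pi_iff\<close>)

lemma eval_word_foldr_cons_letter:
  assumes "fst ` set u \<subseteq> X" and "fst ` set w \<subseteq> X" and h: "h \<in> X \<rightarrow> carrier G"
  shows "eval_word G h (foldr cons_letter u w) = eval_word G h u \<otimes> eval_word G h w"
  using assms(1)
proof (induction u)
  case Nil
  then show ?case
    using eval_word_closed[OF assms(2) h] by simp
next
  case (Cons a u)
  have "fst ` set (foldr cons_letter u w) \<subseteq> X"
    using letters_foldr_cons_letter[of u w] Cons.prems assms(2) by fastforce
  moreover have "eval_word G h u \<in> carrier G" "eval_word G h w \<in> carrier G"
      "h (fst a) \<in> carrier G"
    using Cons.prems assms(2) h by (auto intro!: eval_word_closed[OF _ h])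
  ultimately show ?case
    using Cons eval_word_cons_letter[of a X "foldr cons_letter u w" h] h
    by (auto simp: m_assoc)
qed

lemma eval_word_hom:
  assumes "h \<in> X \<rightarrow> carrier G"
  shows "eval_word G h \<in> hom (free_group X) G"
  using eval_word_foldr_cons_letter[OF _ _ assms] eval_word_closed[OF _ assms]
  by (auto simp: hom_def free_group_def)

end

text \<open>The universal property: send an element to its reduced word by inverting
  \<open>\<phi>\<close>, then evaluate that word in \<open>H\<close>. It supplies both the integer
  weights and the representations in \<open>SL2\<close>.\<close>

lemma freely_generated_extend:
  assumes free: "freely_generated G n g" and H: "group H"
    and h: "h \<in> g ` {1..n} \<rightarrow> carrier H"
  obtains \<psi> where "\<psi> \<in> hom G H" and "\<And>s. s \<in> g ` {1..n} \<Longrightarrow> \<psi> s = h s"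
proof -
  obtain \<phi> where \<phi>: "\<phi> \<in> iso (free_group {1..n}) G" "\<And>i. i \<in> {1..n} \<Longrightarrow> \<phi> [(i, True)] = g i"
    using free unfolding freely_generated_def by blast
  define \<theta> where "\<theta> = inv_into (carrier (free_group {1..n})) \<phi>"
  have \<theta>: "\<theta> \<in> hom G (free_group {1..n})"
    using group.iso_set_sym[OF group_free_group \<phi>(1)] by (simp add: \<theta>_def iso_def)
  have ev: "eval_word H (h \<circ> g) \<in> hom (free_group {1..n}) H"
    using h by (intro group.eval_word_hom[OF H]) auto
  show thesis
  proof
    show "eval_word H (h \<circ> g) \<circ> \<theta> \<in> hom G H"
      using \<theta> ev by (rule hom_compose)
  next
    fix s assume "s \<in> g ` {1..n}"
    then obtain i where i: "i \<in> {1..n}" "s = g i" by blast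
    then have "[(i, True)] \<in> carrier (free_group {1..n})"
      by (simp add: free_group_def)
    moreover have "inj_on \<phi> (carrier (free_group {1..n}))"
      using \<phi>(1) by (simp add: iso_def bij_betw_def)
    ultimately have "\<theta> s = [(i, True)]"
      using i \<phi>(2) by (metis \<theta>_def inv_into_f_f)
    moreover have "h (g i) \<in> carrier H"
      using h i by blast
    ultimately show "(eval_word H (h \<circ> g) \<circ> \<theta>) s = h s"
      using i H by (simp add: group.is_monoid)
  qed
qed


section \<open>Unimodular matrices of size two\<close>

text \<open>A quadruple lists the entries of a 2x2 integer matrix row by row; the defining equation
  says that the determinant is 1.\<close>

definition SL2 :: "(int \<times> int \<times> int \<times> int) monoid" where
  "SL2 = \<lparr>carrier = {(a, b, c, d). a * d - b * c = 1},
     mult = (\<lambda>(a, b, c, d) (a', b', c', d').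
       (a * a' + b * c', a * b' + b * d', c * a' + d * c', c * b' + d * d')),
     one = (1, 0, 0, 1)\<rparr>"

definition SL2_trace :: "int \<times> int \<times> int \<times> int \<Rightarrow> int" where
  "SL2_trace = (\<lambda>(a, b, c, d). a + d)"

definition upper :: "int \<Rightarrow> int \<times> int \<times> int \<times> int" where
  "upper s = (1, s, 0, 1)"

definition lower :: "int \<Rightarrow> int \<times> int \<times> int \<times> int" where
  "lower s = (1, 0, s, 1)"

lemma group_SL2: "group SL2"
proof (rule groupI)
  fix x y assume "x \<in> carrier SL2" "y \<in> carrier SL2"
  \<comment> \<open>Multiplicativity of the determinant.\<close>
  moreover have "(a * a' + b * c') * (c * b' + d * d') - (a * b' + b * d') * (c * a' + d * c')
      = (a * d - b * c) * (a' * d' - b' * c')" for a b c d a' b' c' d' :: int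
    by algebra
  ultimately show "x \<otimes>\<^bsub>SL2\<^esub> y \<in> carrier SL2"
    by (auto simp: SL2_def)
next
  fix x assume "x \<in> carrier SL2"
  then obtain a b c d where "x = (a, b, c, d)" "a * d - b * c = 1"
    by (auto simp: SL2_def)
  then show "\<exists>y\<in>carrier SL2. y \<otimes>\<^bsub>SL2\<^esub> x = \<one>\<^bsub>SL2\<^esub>"
    by (intro bexI[of _ "(d, - b, - c, a)"]) (auto simp: SL2_def algebra_simps)
qed (auto simp: SL2_def algebra_simps)

interpretation SL2: group SL2
  by (rule group_SL2)

lemma upper_closed [simp]: "upper s \<in> carrier SL2"
  and lower_closed [simp]: "lower s \<in> carrier SL2"
  by (simp_all add: SL2_def upper_def lower_def)

lemma upper_mult [simp]: "upper s \<otimes>\<^bsub>SL2\<^esub> upper t = upper (s + t)"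
  and lower_mult [simp]: "lower s \<otimes>\<^bsub>SL2\<^esub> lower t = lower (s + t)"
  by (simp_all add: SL2_def upper_def lower_def)

text \<open>Both unipotent families are one-parameter subgroups, so their integer powers reduce to
  multiples in the integers.\<close>

lemma upper_hom: "upper \<in> hom integer_group SL2" and lower_hom: "lower \<in> hom integer_group SL2"
  by (auto intro!: homI)

lemma upper_pow [simp]: "upper s [^]\<^bsub>SL2\<^esub> (k::int) = upper (k * s)"
  using hom_int_pow[OF upper_hom _ group_integer_group group_SL2, of s k] by simp

lemma lower_pow [simp]: "lower s [^]\<^bsub>SL2\<^esub> (k::int) = lower (k * s)"
  using hom_int_pow[OF lower_hom _ group_integer_group group_SL2, of s k] by simp

lemma upper_inv [simp]: "inv\<^bsub>SL2\<^esub> upper s = upper (- s)"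
  by (rule SL2.inv_equality) (simp_all, simp add: SL2_def upper_def)

lemma lower_inv [simp]: "inv\<^bsub>SL2\<^esub> lower s = lower (- s)"
  by (rule SL2.inv_equality) (simp_all, simp add: SL2_def lower_def)

lemma SL2_trace_commute: "SL2_trace (x \<otimes>\<^bsub>SL2\<^esub> y) = SL2_trace (y \<otimes>\<^bsub>SL2\<^esub> x)"
  by (simp add: SL2_def SL2_trace_def split: prod.splits)

lemma SL2_trace_conj:
  assumes "x \<in> carrier SL2" and "y \<in> carrier SL2"
  shows "SL2_trace (y \<otimes>\<^bsub>SL2\<^esub> x \<otimes>\<^bsub>SL2\<^esub> inv\<^bsub>SL2\<^esub> y) = SL2_trace x"
  using assms by (simp add: SL2_trace_commute[of "y \<otimes>\<^bsub>SL2\<^esub> x"] SL2.m_assoc[symmetric])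

lemma SL2_trace_alternating:
  "SL2_trace (upper s \<otimes>\<^bsub>SL2\<^esub> lower t) = 2 + s * t"
  "SL2_trace (lower t \<otimes>\<^bsub>SL2\<^esub> upper s) = 2 + s * t"
  "SL2_trace (lower t \<otimes>\<^bsub>SL2\<^esub> (upper s \<otimes>\<^bsub>SL2\<^esub> (lower t' \<otimes>\<^bsub>SL2\<^esub> upper s'))) =
     2 + (s + s') * (t + t') + s * t * s' * t'"
  by (simp_all add: SL2_def SL2_trace_def upper_def lower_def algebra_simps)

section \<open>Products of powers\<close>

text \<open>Unlike a list of pairs, this separates the order of the factors (the list) from the
  exponents (the function \<open>e\<close>): homomorphisms to the integers determine the exponents
  but not the order. The map \<open>h\<close> allows the same product to be formed in an image of
  the group.\<close>

definition power_prod ::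
    "('b, 'c) monoid_scheme \<Rightarrow> ('a \<Rightarrow> 'b) \<Rightarrow> ('a \<Rightarrow> int) \<Rightarrow> 'a list \<Rightarrow> 'b" where
  "power_prod G h e as = foldr (\<lambda>a z. h a [^]\<^bsub>G\<^esub> e a \<otimes>\<^bsub>G\<^esub> z) as \<one>\<^bsub>G\<^esub>"

lemma power_prod_simps [simp]:
  "power_prod G h e [] = \<one>\<^bsub>G\<^esub>"
  "power_prod G h e (a # as) = h a [^]\<^bsub>G\<^esub> e a \<otimes>\<^bsub>G\<^esub> power_prod G h e as"
  by (simp_all add: power_prod_def)

lemma (in group) power_prod_closed:
  "h ` set as \<subseteq> carrier G \<Longrightarrow> power_prod G h e as \<in> carrier G"
  by (induction as) auto

lemma (in group_hom) hom_power_prod: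
  "f ` set as \<subseteq> carrier G \<Longrightarrow> h (power_prod G f e as) = power_prod H (h \<circ> f) e as"
  by (induction as) (auto simp: G.power_prod_closed hom_int_pow)

lemma power_prod_integer_group:
  "power_prod integer_group w e as = (\<Sum>a\<leftarrow>as. e a * w a)"
  by (induction as) auto

lemma (in group) power_prod_filter:
  assumes "h ` set as \<subseteq> carrier G" and "\<And>a. a \<in> set as \<Longrightarrow> \<not> P a \<Longrightarrow> h a = \<one>"
  shows "power_prod G h e as = power_prod G h e (filter P as)"
  using assms
proof (induction as)
  case (Cons a as)
  then have "h ` set (filter P as) \<subseteq> carrier G" by auto
  with Cons show ?case by (auto simp: power_prod_closed)
qed simp

lemma power_prod_cong:
  assumes "\<And>a. a \<in> set as \<Longrightarrow> h a = h' a" and "\<And>a. a \<in> set as \<Longrightarrow> e a = e' a"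
  shows "power_prod G h e as = power_prod G h' e' as"
  using assms by (induction as) auto

section \<open>Orderings of a finite set, and sets of naturals closed under differences\<close>

text \<open>At the first position where the lists differ, let their entries be \<open>a\<close> and
  \<open>b\<close>. As both lists have the same elements, each of the two occurs later in the other
  list.\<close>

lemma distinct_lists_reversed_pair:
  assumes "distinct as" "distinct bs" "set as = set bs" "as \<noteq> bs"
  obtains a b where "a \<noteq> b" "a \<in> set as" "b \<in> set as"
    "filter (\<lambda>c. c = a \<or> c = b) as = [a, b]"
    "filter (\<lambda>c. c = a \<or> c = b) bs = [b, a]"
proof -
  have single: "filter (\<lambda>c. c = a \<or> c = b) cs = [b]" "filter (\<lambda>c. c = b \<or> c = a) cs = [b]"
    if "distinct cs" "a \<notin> set cs" "b \<in> set cs" for a b :: 'a and cs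
    using that by (induction cs) (auto simp: filter_empty_conv)
  have "\<exists>a b. a \<noteq> b \<and> a \<in> set as \<and> b \<in> set as \<and> filter (\<lambda>c. c = a \<or> c = b) as = [a, b] \<and>
      filter (\<lambda>c. c = a \<or> c = b) bs = [b, a]"
    using assms
  proof (induction as arbitrary: bs)
    case (Cons a as)
    then obtain b bs' where bs: "bs = b # bs'"
      by (cases bs) auto
    show ?case
    proof (cases "a = b")
      case True
      with Cons.prems bs have "set as = set bs'" "as \<noteq> bs'" "distinct as" "distinct bs'"
        by auto
      with Cons.IH[of bs'] obtain c d where *: "c \<noteq> d" "c \<in> set as" "d \<in> set as"
          "filter (\<lambda>x. x = c \<or> x = d) as = [c, d]" "filter (\<lambda>x. x = c \<or> x = d) bs' = [d, c]"
        by blast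
      with Cons.prems have "a \<noteq> c" "a \<noteq> d" by auto
      with * True bs show ?thesis
        by (intro exI[of _ c] exI[of _ d]) auto
    next
      case False
      with Cons.prems bs have "b \<in> set as" "a \<in> set bs'" "b \<notin> set bs'" "a \<notin> set as"
        by auto
      with Cons.prems bs False single[of as a b] single[of bs' b a] show ?thesis
        by (intro exI[of _ a] exI[of _ b]) simp
    qed
  qed simp
  with that show thesis by blast
qed

text \<open>Subtracting the least nonzero element \<open>\<delta>\<close> does not leave
  \<open>D\<close>. Descent therefore shows that \<open>\<delta>\<close> divides every element, and
  descent from the maximum meets every smaller multiple.\<close>

lemma nat_subset_closed_under_diff:
  fixes D :: "nat set"
  assumes "finite D" "0 \<in> D" "D \<noteq> {0}"
    and diff: "\<And>a b. a \<in> D \<Longrightarrow> b \<in> D \<Longrightarrow> a < b \<Longrightarrow> b - a \<in> D"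
  obtains \<delta> M where "\<delta> > 0" "D = (\<lambda>k. k * \<delta>) ` {..M}"
proof -
  define \<delta> where "\<delta> = (LEAST d. d \<in> D \<and> d \<noteq> 0)"
  have "\<exists>d. d \<in> D \<and> d \<noteq> 0"
    using assms(2,3) by blast
  then have \<delta>: "\<delta> \<in> D" "\<delta> \<noteq> 0"
    unfolding \<delta>_def by (metis (mono_tags, lifting) LeastI)+
  have least: "\<delta> \<le> d" if "d \<in> D" "d \<noteq> 0" for d
    unfolding \<delta>_def using that by (simp add: Least_le)
  have dvd: "d \<in> D \<Longrightarrow> \<delta> dvd d" for d
  proof (induction d rule: less_induct)
    case (less d)
    show ?case
    proof (cases "d = 0 \<or> d = \<delta>")
      case False
      with least[of d] less.prems have "\<delta> < d" by auto
      with diff[OF \<delta>(1) less.prems] less.IH[of "d - \<delta>"] \<delta>(2) show ?thesis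
        by (simp add: dvd_diff_nat)
          (metis dvd_diffD less_imp_le dvd_refl)
    qed auto
  qed
  have Max: "Max D \<in> D" and D_le: "d \<in> D \<Longrightarrow> d \<le> Max D" for d
    using assms(1,2) by (auto intro!: Max_in)
  define M where "M = Max D div \<delta>"
  have M: "M * \<delta> \<in> D"
    using Max dvd[OF Max] by (simp add: M_def)
  \<comment> \<open>Here \<open>k\<close> counts the subtractions of \<open>\<delta>\<close>. Since
    \<open>diff\<close> asks for a strict inequality, the multiple 0 comes from the assumption
    \<open>0 \<in> D\<close> instead.\<close>
  have down: "k \<le> M \<Longrightarrow> (M - k) * \<delta> \<in> D" for k
  proof (induction k)
    case 0
    show ?case using M by simp
  next
    case (Suc k)
    then have *: "(M - k) * \<delta> = (M - Suc k) * \<delta> + \<delta>"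
      by (metis Suc_diff_Suc Suc_le_lessD add.commute mult_Suc)
    show ?case
    proof (cases "M - Suc k = 0")
      case False
      with diff[OF \<delta>(1) Suc.IH] Suc.prems * \<delta>(2) show ?thesis
        by simp
    qed (use assms(2) in simp)
  qed
  have "D = (\<lambda>k. k * \<delta>) ` {..M}"
  proof
    show "D \<subseteq> (\<lambda>k. k * \<delta>) ` {..M}"
    proof
      fix d assume "d \<in> D"
      then have "d = (d div \<delta>) * \<delta>" "d div \<delta> \<le> M"
        using dvd[of d] D_le[of d] by (auto simp: M_def div_le_mono)
      then show "d \<in> (\<lambda>k. k * \<delta>) ` {..M}" by blast
    qed
    show "(\<lambda>k. k * \<delta>) ` {..M} \<subseteq> D"
      using down by (metis atMost_iff diff_diff_cancel diff_le_self image_subsetI)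
  qed
  with that \<delta>(2) show thesis by blast
qed


section \<open>Positive normal constellations\<close>

locale free_basis = group G for G :: "('a, 'b) monoid_scheme" (structure) +
  fixes n :: nat and g :: "nat \<Rightarrow> 'a"
  assumes free: "freely_generated G n g"
begin

abbreviation gens :: "'a set" where
  "gens \<equiv> g ` {1..n}"

lemma gens_closed: "gens \<subseteq> carrier G"
  using free by (auto simp: freely_generated_def)

section \<open>Homomorphisms to the integers\<close>

text \<open>Freeness guarantees that such a homomorphism exists. Keeping \<open>w\<close> arbitrary
  lets one equation serve all exponent sums and the total exponent at once.\<close>

definition weight :: "('a \<Rightarrow> int) \<Rightarrow> 'a \<Rightarrow> int" where
  "weight w = (SOME \<psi>. \<psi> \<in> hom G integer_group \<and> (\<forall>s\<in>gens. \<psi> s = w s))"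

abbreviation exponent_sum :: "'a \<Rightarrow> 'a \<Rightarrow> int" where
  "exponent_sum s \<equiv> weight (\<lambda>t. if t = s then 1 else 0)"

abbreviation total :: "'a \<Rightarrow> int" where
  "total \<equiv> weight (\<lambda>_. 1)"

lemma weight_hom: "weight w \<in> hom G integer_group"
  and weight_gens: "s \<in> gens \<Longrightarrow> weight w s = w s"
proof -
  have "\<exists>\<psi>. \<psi> \<in> hom G integer_group \<and> (\<forall>s\<in>gens. \<psi> s = w s)"
    using freely_generated_extend[OF free group_integer_group, of w]
    by (metis UNIV_I Pi_I carrier_integer_group)
  from someI_ex[OF this] show "weight w \<in> hom G integer_group"
    and "s \<in> gens \<Longrightarrow> weight w s = w s"
    unfolding weight_def by blast+
qed

lemma weight_group_hom: "group_hom G integer_group (weight w)"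
  by (simp add: group_hom_def group_hom_axioms_def weight_hom)

lemma weight_mult:
  "x \<in> carrier G \<Longrightarrow> y \<in> carrier G \<Longrightarrow> weight w (x \<otimes> y) = weight w x + weight w y"
  using hom_mult[OF weight_hom] by simp

lemma weight_inv: "x \<in> carrier G \<Longrightarrow> weight w (inv x) = - weight w x"
  using group_hom.hom_inv[OF weight_group_hom] by simp

lemma weight_one [simp]: "weight w \<one> = 0"
  using group_hom.hom_one[OF weight_group_hom] by simp

lemma weight_conj:
  "x \<in> carrier G \<Longrightarrow> u \<in> carrier G \<Longrightarrow> weight w (u \<otimes> x \<otimes> inv u) = weight w x"
  by (simp add: weight_mult weight_inv)

lemma weight_power_prod:
  assumes "set as \<subseteq> gens"
  shows "weight w (power_prod G (\<lambda>a. a) e as) = (\<Sum>a\<leftarrow>as. e a * w a)"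
proof -
  have "weight w (power_prod G (\<lambda>a. a) e as) = power_prod integer_group (weight w) e as"
    using group_hom.hom_power_prod[OF weight_group_hom, of "\<lambda>a. a" as w e] assms gens_closed
    by (auto simp: comp_def)
  also have "\<dots> = power_prod integer_group w e as"
    using assms by (intro power_prod_cong) (auto simp: weight_gens)
  finally show ?thesis
    by (simp add: power_prod_integer_group)
qed

lemma exponent_sum_power_prod:
  assumes "distinct as" "set as \<subseteq> gens"
  shows "exponent_sum s (power_prod G (\<lambda>a. a) e as) = (if s \<in> set as then e s else 0)"
proof -
  have "(\<lambda>a. e a * (if a = s then 1 else 0)) = (\<lambda>a. if a = s then e a else 0)"
    by auto
  with assms show ?thesis
    by (simp add: weight_power_prod sum_list_distinct_conv_sum_set)
qed

section \<open>Positive normal elements as products of powers\<close>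

lemma weight_reduced_form:
  assumes "reduced_form G gens aps x"
  shows "weight w x = (\<Sum>(a, p)\<leftarrow>aps. p * w a)"
proof -
  have "foldr (\<otimes>) (map (\<lambda>(a, p). a [^] p) aps) \<one> \<in> carrier G \<and>
      weight w (foldr (\<otimes>) (map (\<lambda>(a, p). a [^] p) aps) \<one>) = (\<Sum>(a, p)\<leftarrow>aps. p * w a)"
    if "\<forall>(a, p)\<in>set aps. a \<in> gens"
    using that
  proof (induction aps)
    case (Cons ap aps)
    obtain a p where ap: "ap = (a, p)" by fastforce
    with Cons.prems have a: "a \<in> gens" "a \<in> carrier G"
      using gens_closed by auto
    then have "weight w (a [^] p) = p * w a"
      using hom_int_pow[OF weight_hom, of a w p] is_group by (simp add: weight_gens)
    with Cons a ap show ?case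
      by (auto simp: weight_mult)
  qed simp
  moreover have "\<forall>(a, p)\<in>set aps. a \<in> gens"
    using assms by (auto simp: reduced_form_def)
  ultimately show ?thesis
    using assms by (auto simp: reduced_form_def)
qed

text \<open>Normality and positivity each provide a reduced form of their own. The two are compared
  through exponent sums rather than by uniqueness of reduced forms: the positive one makes all
  exponent sums nonnegative, and in the normal one each exponent equals an exponent sum, as no
  generator is repeated.\<close>

lemma positive_normal_power_prod:
  assumes "normal_element G gens x" "positive_element G gens x"
  obtains as where "distinct as" "set as = {s \<in> gens. exponent_sum s x > 0}"
    "power_prod G (\<lambda>a. a) (\<lambda>a. exponent_sum a x) as = x"
proof -
  obtain aps where aps: "reduced_form G gens aps x" "distinct (map fst aps)"
    using assms(1) by (auto simp: normal_element_def)
  obtain bps where bps: "reduced_form G gens bps x" "\<forall>(a, p)\<in>set bps. p > 0"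
    using assms(2) by (auto simp: positive_element_def)
  have nonneg: "exponent_sum s x \<ge> 0" for s
    using bps(2) unfolding weight_reduced_form[OF bps(1)] by (force intro!: sum_list_nonneg)
  have "(\<Sum>(a, p)\<leftarrow>aps. p * (if a = b then 1 else 0)) = q"
    if "(b, q) \<in> set aps" "distinct (map fst aps)" for b and q :: int and aps
    using that
  proof (induction aps)
    case (Cons ap aps)
    show ?case
    proof (cases "ap = (b, q)")
      case True
      with Cons.prems have "b \<notin> fst ` set aps"
        by simp
      then have "(\<Sum>(a, p)\<leftarrow>aps. p * (if a = b then 1 else 0)) = (\<Sum>ap\<leftarrow>aps. 0)"
        by (intro arg_cong[where f = sum_list] map_cong) (auto simp: image_iff)
      with True show ?thesis by simp
    next
      case False
      with Cons.prems have bq: "(b, q) \<in> set aps"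
        by auto
      then have "b \<in> fst ` set aps"
        by force
      with Cons.prems have "fst ap \<noteq> b"
        by auto
      with Cons bq show ?thesis by (auto simp: case_prod_beta)
    qed
  qed simp
  then have exps: "exponent_sum b x = q" if "(b, q) \<in> set aps" for b q
    using that aps weight_reduced_form by simp
  have x: "x = foldr (\<otimes>) (map (\<lambda>(a, p). a [^] p) aps) \<one>"
    and aps': "\<forall>(a, p)\<in>set aps. a \<in> gens \<and> p \<noteq> 0"
    using aps(1) by (auto simp: reduced_form_def)
  have "foldr (\<otimes>) (map (\<lambda>(a, p). a [^] p) aps) \<one> =
      power_prod G (\<lambda>a. a) (\<lambda>a. exponent_sum a x) (map fst aps)"
    using exps
  proof (induction aps)
    case (Cons ap aps)
    then have "exponent_sum (fst ap) x = snd ap"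
      by (cases ap) simp
    moreover have "foldr (\<otimes>) (map (\<lambda>(a, p). a [^] p) aps) \<one> =
        power_prod G (\<lambda>a. a) (\<lambda>a. exponent_sum a x) (map fst aps)"
      using Cons by simp
    ultimately show ?case
      by (cases ap) simp
  qed simp
  then have x_eq: "power_prod G (\<lambda>a. a) (\<lambda>a. exponent_sum a x) (map fst aps) = x"
    by (rule trans[OF sym, OF _ x[symmetric]])
  have sub: "set (map fst aps) \<subseteq> gens"
    using aps' by auto
  have "set (map fst aps) = {s \<in> gens. exponent_sum s x > 0}"
  proof (rule Set.set_eqI, rule iffI)
    fix s assume s: "s \<in> set (map fst aps)"
    then obtain p where "(s, p) \<in> set aps" by auto
    with exps[of s p] aps' nonneg[of s] show "s \<in> {s \<in> gens. exponent_sum s x > 0}"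
      by auto
  next
    fix s assume s: "s \<in> {s \<in> gens. exponent_sum s x > 0}"
    show "s \<in> set (map fst aps)"
    proof (rule ccontr)
      assume "s \<notin> set (map fst aps)"
      then have "exponent_sum s x = 0"
        using exponent_sum_power_prod[OF aps(2) sub, of s "\<lambda>a. exponent_sum a x"] x_eq by simp
      with s show False by simp
    qed
  qed
  with x_eq aps(2) that show thesis by blast
qed

lemma positive_normal_constellation_power_prod:
  assumes "positive_normal_constellation G gens V" "x \<in> V"
  obtains as where "distinct as" "set as = {s \<in> gens. exponent_sum s x > 0}"
    "power_prod G (\<lambda>a. a) (\<lambda>a. exponent_sum a x) as = x"
proof (cases "x = \<one>")
  \<comment> \<open>The constellation conditions exempt the identity; the empty product represents
    it.\<close>
  case True
  then show thesis using that[of "[]"] by simp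
next
  case False
  with assms have "normal_element G gens x" "positive_element G gens x"
    by (auto simp: positive_normal_constellation_def positive_constellation_def
        normal_constellation_def)
  then show thesis
    using positive_normal_power_prod that by blast
qed

lemma positive_normal_constellation_total:
  assumes "positive_normal_constellation G gens V" "x \<in> V"
  shows "total x \<ge> 0" and "x \<noteq> \<one> \<Longrightarrow> total x > 0"
proof -
  obtain as where as: "distinct as" "set as = {s \<in> gens. exponent_sum s x > 0}"
    "power_prod G (\<lambda>a. a) (\<lambda>a. exponent_sum a x) as = x"
    by (rule positive_normal_constellation_power_prod[OF assms])
  have tot: "total x = (\<Sum>a\<leftarrow>as. exponent_sum a x)"
    using weight_power_prod[of as "\<lambda>_. 1" "\<lambda>a. exponent_sum a x", unfolded as(3)] as(2)
    by auto
  have pos: "exponent_sum a x > 0" if "a \<in> set as" for a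
    using as(2) that by blast
  have nonneg: "(\<Sum>a\<leftarrow>bs. exponent_sum a x) \<ge> 0" if "set bs \<subseteq> set as" for bs
    using that
  proof (induction bs)
    case (Cons b bs)
    with pos[of b] show ?case by simp
  qed simp
  show "total x \<ge> 0"
    unfolding tot by (rule nonneg) simp
  show "total x > 0" if "x \<noteq> \<one>"
  proof (cases as)
    case Nil
    with as(3) that show ?thesis by simp
  next
    case (Cons b bs)
    then have "set bs \<subseteq> set as" "b \<in> set as" by auto
    with tot pos[of b] nonneg[of bs] Cons show ?thesis by simp
  qed
qed

section \<open>The arithmetic progression of total exponents\<close>

text \<open>Equivalence leaves open whether \<open>inv x \<otimes> y\<close> is conjugate to
  \<open>z\<close> or to its inverse. The total exponent decides: the inverse would have negative
  total, against \<open>total x \<le> total y\<close>. Conjugation does not affect weights, so they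
  add up.\<close>

lemma weak_group_structure_step:
  assumes V: "positive_normal_constellation G gens V" "weak_group_structure G V"
    and x: "x \<in> V" and y: "y \<in> V" and "x \<noteq> y" and le: "total x \<le> total y"
  obtains z u where "z \<in> V" "z \<noteq> \<one>" "u \<in> carrier G" "inv x \<otimes> y = u \<otimes> z \<otimes> inv u"
    "\<And>w. weight w y = weight w x + weight w z"
proof -
  have closed: "x \<in> carrier G" "y \<in> carrier G"
    using V(2) x y by (auto simp: weak_group_structure_def)
  obtain z where z: "z \<in> V" "equivalent G (inv x \<otimes> y) z"
    using V(2) x y \<open>x \<noteq> y\<close> unfolding weak_group_structure_def by blast
  then obtain u where u: "u \<in> carrier G" "z \<in> carrier G"
    "inv x \<otimes> y = u \<otimes> z \<otimes> inv u \<or> inv x \<otimes> y = u \<otimes> inv z \<otimes> inv u"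
    by (auto simp: equivalent_def)
  have "z \<noteq> \<one>"
  proof
    assume "z = \<one>"
    with u have "inv x \<otimes> y = \<one>" by auto
    with closed \<open>x \<noteq> y\<close> show False
      by (metis inv_closed inv_equality inv_inv)
  qed
  have xy: "weight w (inv x \<otimes> y) = weight w y - weight w x" for w
    using closed by (simp add: weight_mult weight_inv)
  have "inv x \<otimes> y \<noteq> u \<otimes> inv z \<otimes> inv u"
  proof
    assume "inv x \<otimes> y = u \<otimes> inv z \<otimes> inv u"
    then have "total y - total x = - total z"
      using xy[of "\<lambda>_. 1"] u by (simp add: weight_conj weight_inv)
    with le positive_normal_constellation_total(2)[OF V(1) z(1) \<open>z \<noteq> \<one>\<close>] show False
      by simp
  qed
  with u have eq: "inv x \<otimes> y = u \<otimes> z \<otimes> inv u" by blast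
  then have "weight w y = weight w x + weight w z" for w
    using xy[of w] u by (simp add: weight_conj)
  with z(1) \<open>z \<noteq> \<one>\<close> u(1) eq that show thesis by blast
qed

lemma weak_group_structure_chain:
  assumes V: "positive_normal_constellation G gens V" "weak_group_structure G V"
    and "finite V" "\<one> \<in> V" "V \<noteq> {\<one>}"
  obtains x M where "V = x ` {..M::nat}" "inj_on x {..M}" "x 0 = \<one>" "M \<ge> 1"
    "\<forall>k\<le>M. \<forall>w. weight w (x k) = int k * weight w (x 1)"
    "\<forall>k. 1 \<le> k \<and> Suc k \<le> M \<longrightarrow>
       (\<exists>u\<in>carrier G. inv (x 1) \<otimes> x (Suc k) = u \<otimes> x k \<otimes> inv u)"
proof -
  define d where "d = nat \<circ> total"
  have total_d: "total v = int (d v)" if "v \<in> V" for v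
    using positive_normal_constellation_total(1)[OF V(1) that] by (simp add: d_def)
  have d_pos: "d v > 0" if "v \<in> V" "v \<noteq> \<one>" for v
    using positive_normal_constellation_total(2)[OF V(1) that] by (simp add: d_def)
  have d_one: "d \<one> = 0"
    by (simp add: d_def)
  \<comment> \<open>Two distinct elements of equal total would yield a nonidentity \<open>z\<close>
    in \<open>V\<close> of total 0. So the total identifies an element of \<open>V\<close>.\<close>
  have inj: "inj_on d V"
  proof (rule inj_onI, rule ccontr)
    fix a b assume ab: "a \<in> V" "b \<in> V" "d a = d b" "a \<noteq> b"
    then have "total a \<le> total b" by (simp add: total_d)
    then obtain z where "z \<in> V" "z \<noteq> \<one>" "total b = total a + total z"
      using weak_group_structure_step[OF V ab(1,2,4)] by blast
    with ab d_pos total_d show False by fastforce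
  qed
  obtain v where v: "v \<in> V" "v \<noteq> \<one>"
    using assms(4,5) by blast
  have "d v \<in> d ` V" "d v \<noteq> 0" "d \<one> \<in> d ` V"
    using v d_pos[OF v] assms(4) by auto
  then have "finite (d ` V)" "0 \<in> d ` V" "d ` V \<noteq> {0}"
    using assms(3) d_one by (simp_all, metis singletonD)
  moreover have "q - p \<in> d ` V" if pq: "p \<in> d ` V" "q \<in> d ` V" "p < q" for p q
  proof -
    obtain a b where ab: "a \<in> V" "b \<in> V" "p = d a" "q = d b"
      using pq(1,2) by blast
    then have "a \<noteq> b" "total a \<le> total b"
      using pq(3) by (auto simp: total_d)
    then obtain z where "z \<in> V" "total b = total a + total z"
      using weak_group_structure_step[OF V ab(1,2)] by blast
    with ab have "q - p = d z" by (simp add: total_d)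
    with \<open>z \<in> V\<close> show ?thesis by blast
  qed
  ultimately obtain \<delta> M where \<delta>: "\<delta> > 0" and D: "d ` V = (\<lambda>k. k * \<delta>) ` {..M}"
    by (rule nat_subset_closed_under_diff)
  \<comment> \<open>The unique element of \<open>V\<close> with total exponent
    \<open>k * \<delta>\<close>, for \<open>k \<le> M\<close>.\<close>
  define x where "x k = inv_into V d (k * \<delta>)" for k
  have x: "x k \<in> V" "d (x k) = k * \<delta>" if "k \<le> M" for k
  proof -
    have "k * \<delta> \<in> d ` V" using D that by blast
    then show "x k \<in> V" "d (x k) = k * \<delta>"
      by (simp_all add: x_def inv_into_into f_inv_into_f)
  qed
  have V_eq: "V = x ` {..M}"
  proof
    show "V \<subseteq> x ` {..M}"
    proof
      fix v assume "v \<in> V"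
      then obtain k where "k \<le> M" "d v = k * \<delta>"
        using D by blast
      with x[of k] \<open>v \<in> V\<close> inj show "v \<in> x ` {..M}"
        by (metis atMost_iff image_eqI inj_onD)
    qed
  qed (use x in auto)
  have x_inj: "inj_on x {..M}"
    using x(2) \<delta> by (intro inj_onI) (metis atMost_iff mult_right_cancel neq0_conv)
  have x0: "x 0 = \<one>"
    using x[of 0] assms(4) d_one inj by (metis inj_onD le0 mult_0)
  have M: "M \<ge> 1"
  proof (rule ccontr)
    assume "\<not> M \<ge> 1"
    then have "M = 0" by simp
    with V_eq x0 assms(5) show False by simp
  qed
  have step: "(\<exists>u\<in>carrier G. inv (x 1) \<otimes> x (Suc k) = u \<otimes> x k \<otimes> inv u) \<and>
      (\<forall>w. weight w (x (Suc k)) = weight w (x 1) + weight w (x k))"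
    if k: "1 \<le> k" "Suc k \<le> M" for k
  proof -
    have in_V: "x 1 \<in> V" "x (Suc k) \<in> V" "x k \<in> V"
      using x M k by auto
    have ds: "d (x 1) = \<delta>" "d (x (Suc k)) = Suc k * \<delta>" "d (x k) = k * \<delta>"
      using x(2)[of 1] x(2)[of "Suc k"] x(2)[of k] M k by simp_all
    have "x 1 \<noteq> x (Suc k)" using ds \<delta> k by auto
    moreover have "total (x 1) \<le> total (x (Suc k))"
      using in_V ds by (simp add: total_d)
    ultimately obtain z u where z: "z \<in> V" "u \<in> carrier G"
      "inv (x 1) \<otimes> x (Suc k) = u \<otimes> z \<otimes> inv u"
      "\<And>w. weight w (x (Suc k)) = weight w (x 1) + weight w z"
      using weak_group_structure_step[OF V in_V(1,2)] by blast
    \<comment> \<open>The totals give \<open>d z = Suc k * \<delta> - \<delta>\<close>, which is the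
      total of \<open>x k\<close>; injectivity of \<open>d\<close> then identifies
      \<open>z\<close>.\<close>
    have "int (d z) = int (d (x k))"
      using z(4)[of "\<lambda>_. 1"] z(1) in_V ds by (simp add: total_d)
    then have "d z = d (x k)"
      by (simp only: of_nat_eq_iff)
    with inj z(1) in_V have "z = x k" by (meson inj_onD)
    with z show ?thesis by blast
  qed
  have "weight w (x k) = int k * weight w (x 1)" if "k \<le> M" for k w
    using that
  proof (induction k)
    case (Suc k)
    show ?case
    proof (cases "k = 0")
      case False
      with step[of k] Suc show ?thesis by (simp add: algebra_simps)
    qed simp
  qed (simp add: x0)
  with V_eq x_inj x0 M step that show thesis by blast
qed

section \<open>Recovering the order of the generators from traces\<close>

text \<open>Turns a conjugacy in \<open>G\<close> into an equation between integers: extend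
  \<open>h\<close> to a homomorphism into \<open>SL2\<close> and use that the trace is invariant
  under conjugation. The predicate \<open>P\<close> marks the few generators that may have a
  nontrivial image; all other factors disappear.\<close>

lemma SL2_trace_conj_power_prod:
  assumes h: "h ` gens \<subseteq> carrier SL2"
    and gens: "set as \<subseteq> gens" "set bs \<subseteq> gens" "set cs \<subseteq> gens"
    and u: "u \<in> carrier G"
    and conj: "inv (power_prod G (\<lambda>a. a) e as) \<otimes> power_prod G (\<lambda>a. a) e' bs =
      u \<otimes> power_prod G (\<lambda>a. a) e'' cs \<otimes> inv u"
    and P: "\<And>a. a \<in> gens \<Longrightarrow> \<not> P a \<Longrightarrow> h a = \<one>\<^bsub>SL2\<^esub>"
  shows "SL2_trace (inv\<^bsub>SL2\<^esub> (power_prod SL2 h e (filter P as)) \<otimes>\<^bsub>SL2\<^esub>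
      power_prod SL2 h e' (filter P bs)) = SL2_trace (power_prod SL2 h e'' (filter P cs))"
proof -
  obtain \<rho> where \<rho>: "\<rho> \<in> hom G SL2" "\<And>s. s \<in> gens \<Longrightarrow> \<rho> s = h s"
    using freely_generated_extend[OF free group_SL2, of h] h by blast
  interpret \<rho>: group_hom G SL2 \<rho>
    by (simp add: group_hom_def group_hom_axioms_def group_SL2 \<rho>(1))
  have closed: "power_prod G (\<lambda>a. a) f ds \<in> carrier G" if "set ds \<subseteq> gens" for f ds
    using that gens_closed by (intro power_prod_closed) auto
  have img: "\<rho> (power_prod G (\<lambda>a. a) f ds) = power_prod SL2 h f (filter P ds)"
    if "set ds \<subseteq> gens" for f ds
  proof -
    have "\<rho> (power_prod G (\<lambda>a. a) f ds) = power_prod SL2 \<rho> f ds"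
      using \<rho>.hom_power_prod[of "\<lambda>a. a" ds f] that gens_closed by (auto simp: comp_def)
    also have "\<dots> = power_prod SL2 h f ds"
      using that \<rho>(2) by (intro power_prod_cong) auto
    also have "\<dots> = power_prod SL2 h f (filter P ds)"
      using that h P by (intro SL2.power_prod_filter) blast+
    finally show ?thesis .
  qed
  have "inv\<^bsub>SL2\<^esub> (power_prod SL2 h e (filter P as)) \<otimes>\<^bsub>SL2\<^esub> power_prod SL2 h e' (filter P bs) =
      \<rho> (inv (power_prod G (\<lambda>a. a) e as) \<otimes> power_prod G (\<lambda>a. a) e' bs)"
    using closed gens by (simp add: img)
  also have "\<dots> = \<rho> u \<otimes>\<^bsub>SL2\<^esub> power_prod SL2 h e'' (filter P cs) \<otimes>\<^bsub>SL2\<^esub> inv\<^bsub>SL2\<^esub> (\<rho> u)"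
    unfolding conj using closed gens u by (simp add: img)
  finally show ?thesis
    using \<rho>.hom_closed[OF closed[OF gens(3), of e'']] u gens(3)
    by (simp add: SL2_trace_conj img)
qed

text \<open>
  If \<open>a\<close> and \<open>b\<close> occur in opposite order in \<open>as\<close> and \<open>bs\<close>, send \<open>a\<close> to \<open>upper 1\<close>, \<open>b\<close> to \<open>lower 1\<close>
  and all other generators to \<open>1\<close>: by \<open>SL2_trace_alternating\<close>, the traces of the two sides of
  \<open>conj\<close> differ by the square of \<open>(k + 1) e(a) e(b)\<close>.
\<close>

lemma conj_power_prod_same_order:
  assumes as: "distinct as" "set as \<subseteq> gens" "\<And>a. a \<in> set as \<Longrightarrow> e a > 0"
    and bs: "distinct bs" "set bs = set as"
    and k: "k > 0" and u: "u \<in> carrier G"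
    and conj: "inv (power_prod G (\<lambda>a. a) e as) \<otimes> power_prod G (\<lambda>a. a) (\<lambda>a. int (Suc k) * e a) bs =
      u \<otimes> power_prod G (\<lambda>a. a) (\<lambda>a. int k * e a) as \<otimes> inv u"
  shows "bs = as"
proof (rule ccontr)
  assume "bs \<noteq> as"
  then obtain a b where ab: "a \<noteq> b" "a \<in> set as" "b \<in> set as"
    "filter (\<lambda>c. c = a \<or> c = b) as = [a, b]"
    "filter (\<lambda>c. c = a \<or> c = b) bs = [b, a]"
    using distinct_lists_reversed_pair[of as bs] as(1) bs by metis
  define h where "h c = (if c = a then upper 1 else if c = b then lower 1 else \<one>\<^bsub>SL2\<^esub>)" for c
  have h: "h a = upper 1" "h b = lower 1"
    using ab(1) by (simp_all add: h_def)
  have "h ` gens \<subseteq> carrier SL2"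
    by (auto simp: h_def)
  \<comment> \<open>Because \<open>bs\<close> has \<open>b\<close> before \<open>a\<close>, the
    factors on the left alternate with no two adjacent ones merging. This produces the quartic term
    of \<open>SL2_trace_alternating\<close>, absent on the right.\<close>
  from SL2_trace_conj_power_prod[OF this as(2) _ as(2) u conj, of "\<lambda>c. c = a \<or> c = b"]
  have "SL2_trace (lower (- e b) \<otimes>\<^bsub>SL2\<^esub> (upper (- e a) \<otimes>\<^bsub>SL2\<^esub>
      (lower (int (Suc k) * e b) \<otimes>\<^bsub>SL2\<^esub> upper (int (Suc k) * e a)))) =
      SL2_trace (upper (int k * e a) \<otimes>\<^bsub>SL2\<^esub> lower (int k * e b))"
    using ab h as(2) bs by (simp add: h_def SL2.inv_mult_group SL2.m_assoc)
  then have "(int (Suc k) * e a * e b)\<^sup>2 = 0"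
    unfolding SL2_trace_alternating by (simp add: power2_eq_square algebra_simps)
  with as(3)[OF ab(2)] as(3)[OF ab(3)] show False
    by simp
qed

text \<open>
  If \<open>as\<close> starts with \<open>a, b, c\<close>, send both \<open>a\<close> and \<open>c\<close> to \<open>upper 1\<close> and \<open>b\<close> to \<open>lower 1\<close>: the traces
  then differ by \<open>2 e(a) e(b)\<^sup>2 e(c)\<close>.
\<close>

lemma conj_power_prod_length:
  assumes as: "distinct as" "set as \<subseteq> gens" "\<And>a. a \<in> set as \<Longrightarrow> e a > 0"
    and u: "u \<in> carrier G"
    and conj: "inv (power_prod G (\<lambda>a. a) e as) \<otimes> power_prod G (\<lambda>a. a) (\<lambda>a. 2 * e a) as =
      u \<otimes> power_prod G (\<lambda>a. a) e as \<otimes> inv u"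
  shows "length as \<le> 2"
proof (rule ccontr)
  assume "\<not> length as \<le> 2"
  then obtain a b c cs where abc: "as = a # b # c # cs"
    by (cases as; cases "tl as"; cases "tl (tl as)") auto
  define P where "P d \<longleftrightarrow> d = a \<or> d = b \<or> d = c" for d
  define h where "h d = (if d = a \<or> d = c then upper 1 else if d = b then lower 1 else \<one>\<^bsub>SL2\<^esub>)" for d
  have h: "h a = upper 1" "h b = lower 1" "h c = upper 1"
    using as(1) abc by (auto simp: h_def)
  have P: "filter P as = [a, b, c]"
    using as(1) abc by (auto simp: P_def filter_empty_conv)
  have "h ` gens \<subseteq> carrier SL2"
    by (auto simp: h_def)
  moreover have "h d = \<one>\<^bsub>SL2\<^esub>" if "\<not> P d" for d
    using that by (simp add: P_def h_def)
  ultimately have "SL2_trace (inv\<^bsub>SL2\<^esub> (power_prod SL2 h e (filter P as)) \<otimes>\<^bsub>SL2\<^esub>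
      power_prod SL2 h (\<lambda>a. 2 * e a) (filter P as)) = SL2_trace (power_prod SL2 h e (filter P as))"
    by (intro SL2_trace_conj_power_prod[OF _ as(2,2,2) u conj])
  then have eq: "SL2_trace (upper (- e c) \<otimes>\<^bsub>SL2\<^esub> (lower (- e b) \<otimes>\<^bsub>SL2\<^esub> (upper (- e a) \<otimes>\<^bsub>SL2\<^esub>
      (upper (2 * e a) \<otimes>\<^bsub>SL2\<^esub> (lower (2 * e b) \<otimes>\<^bsub>SL2\<^esub> upper (2 * e c)))))) =
      SL2_trace (upper (e a) \<otimes>\<^bsub>SL2\<^esub> (lower (e b) \<otimes>\<^bsub>SL2\<^esub> upper (e c)))"
    by (simp add: P h SL2.inv_mult_group SL2.m_assoc)
  \<comment> \<open>Up to cyclic rotation the left product is \<open>upper (e c)\<close>,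
    \<open>lower (- e b)\<close>, \<open>upper (e a)\<close>, \<open>lower (2 * e b)\<close>, and
    the right one is \<open>upper (e a + e c)\<close>, \<open>lower (e b)\<close>.\<close>
  have "(e b)\<^sup>2 * (e a * e c) = 0"
    using eq by (simp add: SL2_def SL2_trace_def upper_def lower_def power2_eq_square algebra_simps)
  with as(3)[of a] as(3)[of b] as(3)[of c] abc show False
    by simp
qed

section \<open>The shape of the constellation\<close>

theorem positive_normal_weak_group_structure:
  assumes V: "positive_normal_constellation G gens V" "weak_group_structure G V"
    and "finite V" "\<one> \<in> V" "card V \<ge> 3"
  shows "(\<exists>i\<in>{1..n}. \<exists>p::int. V = {(g i [^] p) [^] k | k::nat. k \<le> card V - 1}) \<or>
    (\<exists>i\<in>{1..n}. \<exists>j\<in>{1..n}. i \<noteq> j \<and> (\<exists>(p::int) (q::int).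
       V = {((g i [^] p) [^] k) \<otimes> ((g j [^] q) [^] k) | k::nat. k \<le> card V - 1}))"
proof -
  have "V \<noteq> {\<one>}" using assms(5) by auto
  with V assms(3,4) obtain x M where xV: "V = x ` {..M::nat}" and inj: "inj_on x {..M}"
    and x0: "x 0 = \<one>" and M: "M \<ge> 1"
    and weights: "\<forall>k\<le>M. \<forall>w. weight w (x k) = int k * weight w (x 1)"
    and conj: "\<forall>k. 1 \<le> k \<and> Suc k \<le> M \<longrightarrow>
       (\<exists>u\<in>carrier G. inv (x 1) \<otimes> x (Suc k) = u \<otimes> x k \<otimes> inv u)"
    by (rule weak_group_structure_chain)
  \<comment> \<open>The indices run from 0 to \<open>M\<close>, so \<open>V\<close> has
    \<open>M + 1\<close> elements.\<close>
  have card: "card V - 1 = M"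
    using card_image[OF inj] by (simp add: xV)
  have in_V: "x k \<in> V" if "k \<le> M" for k
    using that by (simp add: xV)
  define e where "e s = exponent_sum s (x 1)" for s
  obtain as where as: "distinct as" "set as = {s \<in> gens. e s > 0}"
    "power_prod G (\<lambda>a. a) e as = x 1"
    unfolding e_def by (rule positive_normal_constellation_power_prod[OF V(1) in_V[OF M]])
  have as_gens: "set as \<subseteq> gens" "\<And>a. a \<in> set as \<Longrightarrow> e a > 0"
    using as(2) by auto
  \<comment> \<open>Induction along the chain: once \<open>x k\<close> is known to have the order
    \<open>as\<close>, the conjugacy of \<open>inv (x 1) \<otimes> x (Suc k)\<close> with
    \<open>x k\<close> forces that order on \<open>x (Suc k)\<close>.\<close>
  have x: "x k = power_prod G (\<lambda>a. a) (\<lambda>a. int k * e a) as" if "1 \<le> k" "k \<le> M" for k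
    using that
  proof (induction k rule: dec_induct)
    case base
    then show ?case using as(3) by simp
  next
    case (step k)
    obtain bs where bs: "distinct bs" "set bs = {s \<in> gens. exponent_sum s (x (Suc k)) > 0}"
      "power_prod G (\<lambda>a. a) (\<lambda>a. exponent_sum a (x (Suc k))) bs = x (Suc k)"
      by (rule positive_normal_constellation_power_prod[OF V(1) in_V[OF step.prems]])
    have exps: "exponent_sum s (x (Suc k)) = int (Suc k) * e s" for s
      unfolding e_def using weights step.prems by blast
    \<comment> \<open>A positive factor \<open>Suc k\<close> does not change which exponents are
      positive, so \<open>bs\<close> and \<open>as\<close> can differ only in order.\<close>
    have "set bs = set as"
      unfolding bs(2) as(2) exps by (simp add: zero_less_mult_iff)
    have x_Suc: "power_prod G (\<lambda>a. a) (\<lambda>a. int (Suc k) * e a) bs = x (Suc k)"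
      using bs(3) unfolding exps .
    have x_k: "power_prod G (\<lambda>a. a) (\<lambda>a. int k * e a) as = x k"
      using step by simp
    obtain u where u: "u \<in> carrier G" "inv (x 1) \<otimes> x (Suc k) = u \<otimes> x k \<otimes> inv u"
      using conj step.hyps(1) step.prems by blast
    have "bs = as"
    proof (rule conj_power_prod_same_order[OF as(1) as_gens bs(1) \<open>set bs = set as\<close> _ u(1)])
      show "inv (power_prod G (\<lambda>a. a) e as) \<otimes> power_prod G (\<lambda>a. a) (\<lambda>a. int (Suc k) * e a) bs =
          u \<otimes> power_prod G (\<lambda>a. a) (\<lambda>a. int k * e a) as \<otimes> inv u"
        unfolding as(3) x_Suc x_k by (rule u(2))
    qed (use step.hyps in auto)
    with x_Suc show ?case by simp
  qed
  \<comment> \<open>At least three elements means that \<open>x 2\<close> exists, so the relation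
    between \<open>x 1\<close> and \<open>x 2\<close> is available to bound the number of
    generators.\<close>
  have M2: "Suc 1 \<le> M" using card assms(5) by simp
  obtain u where u: "u \<in> carrier G" "inv (x 1) \<otimes> x (Suc 1) = u \<otimes> x 1 \<otimes> inv u"
    using conj M2 by blast
  have x_2: "power_prod G (\<lambda>a. a) (\<lambda>a. 2 * e a) as = x (Suc 1)"
    using x[OF _ M2] by simp
  have length: "length as \<le> 2"
  proof (rule conj_power_prod_length[OF as(1) as_gens u(1)])
    show "inv (power_prod G (\<lambda>a. a) e as) \<otimes> power_prod G (\<lambda>a. a) (\<lambda>a. 2 * e a) as =
        u \<otimes> power_prod G (\<lambda>a. a) e as \<otimes> inv u"
      unfolding as(3) x_2 by (rule u(2))
  qed
  \<comment> \<open>An empty list would make \<open>x 1\<close> the identity, which is already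
    \<open>x 0\<close>.\<close>
  have "as \<noteq> []"
    using as(3) x0 inj M by (auto dest: inj_onD[of x _ 1 0])
  with length consider a where "as = [a]" | a b where "as = [a, b]"
    by (cases as; cases "tl as"; cases "tl (tl as)") auto
  \<comment> \<open>Passes from one integer power per generator to the natural powers of
    \<open>A\<close> and \<open>B\<close> in the conclusion. The formula \<open>x\<close> starts at
    \<open>k = 1\<close>; below, \<open>k = 0\<close> is covered by \<open>x0\<close>.\<close>
  moreover have pow: "a [^] (int k * p) = (a [^] p) [^] k" if "a \<in> carrier G" for a p k
    using that by (metis int_pow_int int_pow_pow mult.commute)
  ultimately show ?thesis
  proof cases
    case 1
    then obtain i where i: "i \<in> {1..n}" "a = g i"
      using as_gens by auto
    then have closed: "g i \<in> carrier G"
      using gens_closed by blast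
    have "x k = (g i [^] e a) [^] k" if "k \<le> M" for k
    proof (cases "k = 0")
      case False
      with x[of k] that closed 1 i show ?thesis
        by (simp add: pow)
    qed (simp add: x0)
    then have "V = {(g i [^] e a) [^] k | k::nat. k \<le> card V - 1}"
      unfolding card unfolding xV by (auto simp: image_iff)
    with i show ?thesis by blast
  next
    case 2
    then obtain i j where ij: "i \<in> {1..n}" "a = g i" "j \<in> {1..n}" "b = g j"
      using as_gens by auto
    have "i \<noteq> j" using as(1) 2 ij by auto
    have closed: "g i \<in> carrier G" "g j \<in> carrier G"
      using gens_closed ij by blast+
    have "x k = (g i [^] e a) [^] k \<otimes> (g j [^] e b) [^] k" if "k \<le> M" for k
    proof (cases "k = 0")
      case False
      with x[of k] that closed 2 ij show ?thesis
        by (simp add: pow)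
    qed (simp add: x0)
    then have "V = {((g i [^] e a) [^] k) \<otimes> ((g j [^] e b) [^] k) | k::nat. k \<le> card V - 1}"
      unfolding card unfolding xV by (auto simp: image_iff)
    with ij \<open>i \<noteq> j\<close> show ?thesis by blast
  qed
qed

end

theorem theorem3p12:
  fixes G V :: "(complex^'m^'m) set"
    and g :: "nat \<Rightarrow> complex^'m^'m"
    and n L :: nat
  assumes "subgroup G unitary_group"
    and "freely_generated (unitary_subgroup G) n g"
    and "V \<subseteq> G"
    and "finite V"
    and "positive_normal_constellation (unitary_subgroup G) (g ` {1..n}) V"
    and "mat 1 \<in> V"
    and "card V = L"
    and "L \<ge> 3"
    and "weak_group_structure (unitary_subgroup G) V"
  shows "(\<exists>i\<in>{1..n}. \<exists>p::int. \<exists>A. A = g i [^]\<^bsub>unitary_subgroup G\<^esub> p \<and>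
             V = {A [^]\<^bsub>unitary_subgroup G\<^esub> k | k::nat. k \<le> L - 1})
       \<or> (\<exists>i\<in>{1..n}. \<exists>j\<in>{1..n}. i \<noteq> j \<and> (\<exists>(p::int) (q::int). \<exists>A B.
             A = g i [^]\<^bsub>unitary_subgroup G\<^esub> p \<and> B = g j [^]\<^bsub>unitary_subgroup G\<^esub> q \<and>
             V = {(A [^]\<^bsub>unitary_subgroup G\<^esub> k) ** (B [^]\<^bsub>unitary_subgroup G\<^esub> k) | k::nat. k \<le> L - 1}))"
proof -
  interpret free_basis "unitary_subgroup G" n g
    using assms(2) by (simp add: free_basis_def free_basis_axioms_def freely_generated_def)
  have [simp]: "\<one>\<^bsub>unitary_subgroup G\<^esub> = mat 1"
    by (simp add: unitary_group_def)
  have [simp]: "x \<otimes>\<^bsub>unitary_group\<^esub> y = x ** y" for x y :: "complex^'m^'m"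
    by (simp add: unitary_group_def)
  show ?thesis
    using positive_normal_weak_group_structure[OF assms(5,9,4)] assms(6,8)
    unfolding assms(7)[symmetric] by simp
qed

end
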